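(* Let $(X,d)$ be a complete metric space with a distinguished point $e\in X$, let $E$ be a Banach space, let $\xi:X\to\mathbb{R}$ be $\xi(x)=\max\{d(x,e),1\}$, and let $Z$ be the set $X$ equipped with the metric $$d'(p,q)=\sup\Big\{\Big|\frac{f(p)}{\xi(p)}-\frac{f(q)}{\xi(q)}\Big|: f\in\operatorname{Lip}(X),\ L(f)\le1,\ |f(e)|\le1\Big\}.$$ Then a function $f:X\to E$ belongs to $\operatorname{Lip}(X,E)$ if and only if $\frac{f}{\xi}\in\operatorname{Lip}(Z,E)$. In particular, $T:\operatorname{Lip}(X,E)\to\operatorname{Lip}(Z,E)$, $Tf=\frac{f}{\xi}$, is a linear biseparating map.
   Context: $\operatorname{Lip}(X,E)$ is the space of all (not necessarily bounded) Lipschitz functions $X\to E$, $\operatorname{Lip}(X)$ is the space of real-valued Lipschitz functions on $X$, and $L(f)$ is the Lipschitz constant of $f$. It is known that $d'$ is a metric on $X$, bounded above by $4$. For a function $f$ let $C(f)=\{x: f(x)\neq 0\}$, and write $f\perp_h g$ if $C(f-h)\cap C(g-h)=\emptyset$. A map $T$ between two function spaces is biseparating if it is a bijection and for all $f,g,h$ in its domain: $f\perp_h g\iff Tf\perp_{Th}Tg$. *)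

theory Defs
  imports "HOL-Analysis.Analysis"
begin

text \<open>
  A map defined on the carrier of a metric space is represented by the function that agrees with
  it on the carrier and is \<open>undefined\<close> elsewhere, so that equality of maps is equality in HOL.
  The algebraic operations on such maps are restricted to the carrier accordingly.
\<close>

definition Lip :: "'a metric \<Rightarrow> ('a \<Rightarrow> 'b::real_normed_vector) set" where
  "Lip X = {f \<in> extensional (mspace X). Lipschitz_continuous_map X euclidean_metric f}"

text \<open>The least admissible constant; the infimum is only meaningful for Lipschitz maps.\<close>

definition Lip_const :: "'a metric \<Rightarrow> ('a \<Rightarrow> 'b::real_normed_vector) \<Rightarrow> real" where
  "Lip_const X f =
     Inf {C. 0 \<le> C \<and> (\<forall>x\<in>mspace X. \<forall>y\<in>mspace X. dist (f x) (f y) \<le> C * mdist X x y)}"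

definition xi :: "'a metric \<Rightarrow> 'a \<Rightarrow> 'a \<Rightarrow> real" where
  "xi X e x = max (mdist X x e) 1"

definition dprime :: "'a metric \<Rightarrow> 'a \<Rightarrow> 'a \<Rightarrow> 'a \<Rightarrow> real" where
  "dprime X e p q =
     Sup {\<bar>f p / xi X e p - f q / xi X e q\<bar> | f :: 'a \<Rightarrow> real.
          f \<in> Lip X \<and> Lip_const X f \<le> 1 \<and> \<bar>f e\<bar> \<le> 1}"

text \<open>
  This is the intended space because \<open>dprime X e\<close> is a metric on the carrier whenever
  \<open>e\<close> is a point of \<open>X\<close>; see the lemmas \<open>Metric_space_dprime\<close>, \<open>mspace_Zspace\<close> and
  \<open>mdist_Zspace\<close> below.
\<close>

definition Zspace :: "'a metric \<Rightarrow> 'a \<Rightarrow> 'a metric" where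
  "Zspace X e = metric (mspace X, dprime X e)"

definition div_xi :: "'a metric \<Rightarrow> 'a \<Rightarrow> ('a \<Rightarrow> 'b::real_vector) \<Rightarrow> 'a \<Rightarrow> 'b" where
  "div_xi X e f = (\<lambda>x\<in>mspace X. f x /\<^sub>R xi X e x)"

definition fun_perp ::
  "'a set \<Rightarrow> ('a \<Rightarrow> 'b::ab_group_add) \<Rightarrow> ('a \<Rightarrow> 'b) \<Rightarrow> ('a \<Rightarrow> 'b) \<Rightarrow> bool" where
  "fun_perp S h f g \<longleftrightarrow> {x \<in> S. f x - h x \<noteq> 0} \<inter> {x \<in> S. g x - h x \<noteq> 0} = {}"

text \<open>
  In the next two definitions \<open>A\<close> is a space of functions on \<open>S\<close>, and \<open>B\<close> a space of functions
  on \<open>S'\<close>.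
\<close>

definition biseparating ::
  "'a set \<Rightarrow> ('a \<Rightarrow> 'b::ab_group_add) set \<Rightarrow> 'c set \<Rightarrow> ('c \<Rightarrow> 'd::ab_group_add) set
     \<Rightarrow> (('a \<Rightarrow> 'b) \<Rightarrow> 'c \<Rightarrow> 'd) \<Rightarrow> bool" where
  "biseparating S A S' B T \<longleftrightarrow>
     bij_betw T A B \<and>
     (\<forall>f\<in>A. \<forall>g\<in>A. \<forall>h\<in>A. fun_perp S h f g \<longleftrightarrow> fun_perp S' (T h) (T f) (T g))"

definition linear_map ::
  "'a set \<Rightarrow> ('a \<Rightarrow> 'b::real_vector) set \<Rightarrow> 'c set \<Rightarrow> ('c \<Rightarrow> 'd::real_vector) set
     \<Rightarrow> (('a \<Rightarrow> 'b) \<Rightarrow> 'c \<Rightarrow> 'd) \<Rightarrow> bool" where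
  "linear_map S A S' B T \<longleftrightarrow>
     T \<in> A \<rightarrow> B \<and>
     (\<forall>f\<in>A. \<forall>g\<in>A. T (\<lambda>x\<in>S. f x + g x) = (\<lambda>x\<in>S'. T f x + T g x)) \<and>
     (\<forall>c. \<forall>f\<in>A. T (\<lambda>x\<in>S. c *\<^sub>R f x) = (\<lambda>x\<in>S'. c *\<^sub>R T f x))"

lemma Lip_iff:
  "f \<in> Lip X \<longleftrightarrow> f \<in> extensional (mspace X) \<and>
     (\<exists>B. \<forall>x\<in>mspace X. \<forall>y\<in>mspace X. dist (f x) (f y) \<le> B * mdist X x y)"
  by (auto simp: Lip_def Lipschitz_continuous_map_def)

lemma Lip_restrict:
  assumes "\<And>x y. x \<in> mspace X \<Longrightarrow> y \<in> mspace X \<Longrightarrow> dist (f x) (f y) \<le> B * mdist X x y"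
  shows "(\<lambda>x\<in>mspace X. f x) \<in> Lip X"
  unfolding Lip_iff using assms by (auto intro!: exI[of _ B])

lemma Lip_zero: "(\<lambda>x\<in>mspace X. 0) \<in> Lip X"
  by (rule Lip_restrict[where B = 0]) auto

lemma Lip_add:
  assumes "f \<in> Lip X" "g \<in> Lip X"
  shows "(\<lambda>x\<in>mspace X. f x + g x) \<in> Lip X"
proof -
  obtain B C where
    B: "\<And>x y. x \<in> mspace X \<Longrightarrow> y \<in> mspace X \<Longrightarrow> dist (f x) (f y) \<le> B * mdist X x y" and
    C: "\<And>x y. x \<in> mspace X \<Longrightarrow> y \<in> mspace X \<Longrightarrow> dist (g x) (g y) \<le> C * mdist X x y"
    using assms unfolding Lip_iff by meson
  show ?thesis
  proof (rule Lip_restrict[where B = "B + C"])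
    fix x y assume "x \<in> mspace X" "y \<in> mspace X"
    then show "dist (f x + g x) (f y + g y) \<le> (B + C) * mdist X x y"
      using B[of x y] C[of x y] dist_triangle_add[of "f x" "g x" "f y" "g y"]
      by (simp add: distrib_right)
  qed
qed

lemma Lip_scaleR:
  assumes "f \<in> Lip X"
  shows "(\<lambda>x\<in>mspace X. c *\<^sub>R f x) \<in> Lip X"
proof -
  obtain B where
    B: "\<And>x y. x \<in> mspace X \<Longrightarrow> y \<in> mspace X \<Longrightarrow> dist (f x) (f y) \<le> B * mdist X x y"
    using assms unfolding Lip_iff by meson
  show ?thesis
  proof (rule Lip_restrict[where B = "\<bar>c\<bar> * B"])
    fix x y assume "x \<in> mspace X" "y \<in> mspace X"
    then show "dist (c *\<^sub>R f x) (c *\<^sub>R f y) \<le> \<bar>c\<bar> * B * mdist X x y"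
      using mult_left_mono[OF B[of x y], of "\<bar>c\<bar>"]
      by (simp add: dist_norm scaleR_diff_right[symmetric] mult.assoc)
  qed
qed

lemma Lip_const_le:
  assumes "0 \<le> C"
    "\<And>x y. x \<in> mspace X \<Longrightarrow> y \<in> mspace X \<Longrightarrow> dist (f x) (f y) \<le> C * mdist X x y"
  shows "Lip_const X f \<le> C"
  unfolding Lip_const_def by (rule cInf_lower) (use assms in \<open>auto intro!: bdd_belowI[of _ 0]\<close>)

lemma dist_le_Lip_const:
  assumes f: "f \<in> Lip X" and xy: "x \<in> mspace X" "y \<in> mspace X"
  shows "dist (f x) (f y) \<le> Lip_const X f * mdist X x y"
proof (cases "x = y")
  case True
  moreover have "mdist X y y = 0" using xy by (metis mdist_zero)
  ultimately show ?thesis by simp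
next
  case False
  then have pos: "0 < mdist X x y"
    using xy by (metis mdist_nonneg mdist_zero less_eq_real_def)
  obtain B where
    B: "\<forall>x\<in>mspace X. \<forall>y\<in>mspace X. dist (f x) (f y) \<le> B * mdist X x y"
    using f unfolding Lip_iff by blast
  have "\<forall>x\<in>mspace X. \<forall>y\<in>mspace X. dist (f x) (f y) \<le> max B 0 * mdist X x y"
  proof (intro ballI)
    fix u v assume "u \<in> mspace X" "v \<in> mspace X"
    then have "dist (f u) (f v) \<le> B * mdist X u v" using B by blast
    also have "\<dots> \<le> max B 0 * mdist X u v" by (rule mult_right_mono) auto
    finally show "dist (f u) (f v) \<le> max B 0 * mdist X u v" .
  qed
  then have ne:
    "{C. 0 \<le> C \<and> (\<forall>x\<in>mspace X. \<forall>y\<in>mspace X. dist (f x) (f y) \<le> C * mdist X x y)} \<noteq> {}"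
    by (auto intro!: exI[of _ "max B 0"])
  have "dist (f x) (f y) / mdist X x y \<le> Lip_const X f"
    unfolding Lip_const_def
    by (rule cInf_greatest[OF ne]) (use xy pos in \<open>auto simp: field_simps\<close>)
  then show ?thesis using pos by (simp add: field_simps)
qed

context
  fixes X :: "'a metric" and e :: 'a
  assumes e: "e \<in> mspace X"
begin

private definition adm :: "('a \<Rightarrow> real) set" where
  "adm = {f \<in> Lip X. Lip_const X f \<le> 1 \<and> \<bar>f e\<bar> \<le> 1}"

private abbreviation gap :: "('a \<Rightarrow> real) \<Rightarrow> 'a \<Rightarrow> 'a \<Rightarrow> real" where
  "gap f p q \<equiv> \<bar>f p / xi X e p - f q / xi X e q\<bar>"

private lemma dprime_alt: "dprime X e p q = (SUP f\<in>adm. gap f p q)"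
  unfolding dprime_def adm_def by (rule arg_cong[of _ _ Sup]) auto

private lemma adm_restrict:
  assumes "\<And>x y. x \<in> mspace X \<Longrightarrow> y \<in> mspace X \<Longrightarrow> \<bar>f x - f y\<bar> \<le> mdist X x y" "\<bar>f e\<bar> \<le> 1"
  shows "(\<lambda>x\<in>mspace X. f x) \<in> adm"
  unfolding adm_def
  using assms e
  by (auto intro!: Lip_const_le Lip_restrict[where B = 1] simp: dist_real_def)

private lemma zero_adm: "(\<lambda>x\<in>mspace X. 0) \<in> adm"
  by (rule adm_restrict) auto

private lemma adm_bound:
  assumes f: "f \<in> adm" and p: "p \<in> mspace X"
  shows "\<bar>f p / xi X e p\<bar> \<le> 2"
proof -
  have L: "Lip_const X f * mdist X p e \<le> 1 * mdist X p e"
    using f by (intro mult_right_mono) (auto simp: adm_def)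
  have "dist (f p) (f e) \<le> mdist X p e"
    using dist_le_Lip_const[of f X p e] f p e L by (auto simp: adm_def)
  moreover have "\<bar>f e\<bar> \<le> 1" using f by (simp add: adm_def)
  ultimately have "\<bar>f p\<bar> \<le> 2 * xi X e p" by (auto simp: xi_def dist_real_def)
  moreover have "0 < xi X e p" by (simp add: xi_def)
  ultimately show ?thesis by (simp add: field_simps)
qed

private lemma adm_bound':
  assumes f: "f \<in> adm"
  shows "\<bar>f p / xi X e p\<bar> \<le> 2 + \<bar>undefined\<bar>"
proof (cases "p \<in> mspace X")
  case True
  then show ?thesis using adm_bound[OF f True] by simp
next
  case False
  then have "f p = undefined" using f by (auto simp: adm_def Lip_def extensional_def)
  moreover have "1 \<le> xi X e p" by (simp add: xi_def)
  ultimately have "\<bar>f p / xi X e p\<bar> \<le> \<bar>undefined\<bar>"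
    by (simp add: field_simps mult_le_cancel_left1)
  then show ?thesis by simp
qed

private lemma bdd_gap: "bdd_above ((\<lambda>f. gap f p q) ` adm)"
proof (rule bdd_aboveI2)
  fix f assume "f \<in> adm"
  then show "gap f p q \<le> 4 + 2 * \<bar>undefined\<bar>"
    using adm_bound'[of f p] adm_bound'[of f q] by linarith
qed

private lemma gap_le_dprime: "f \<in> adm \<Longrightarrow> gap f p q \<le> dprime X e p q"
  unfolding dprime_alt by (rule cSUP_upper[OF _ bdd_gap])

private lemma dprime_least: "(\<And>f. f \<in> adm \<Longrightarrow> gap f p q \<le> c) \<Longrightarrow> dprime X e p q \<le> c"
  unfolding dprime_alt using zero_adm by (intro cSUP_least) auto

lemma dprime_le_4:
  assumes "p \<in> mspace X" "q \<in> mspace X"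
  shows "dprime X e p q \<le> 4"
proof (rule dprime_least)
  fix f assume "f \<in> adm"
  then show "gap f p q \<le> 4"
    using adm_bound[of f p] adm_bound[of f q] assms by linarith
qed

lemma Metric_space_dprime: "Metric_space (mspace X) (dprime X e)"
proof
  show "0 \<le> dprime X e p q" for p q
    using gap_le_dprime[OF zero_adm, of p q] by linarith
  show "dprime X e p q = dprime X e q p" for p q
    unfolding dprime_alt by (simp add: abs_minus_commute)
  show "dprime X e p q = 0 \<longleftrightarrow> p = q" if pq: "p \<in> mspace X" "q \<in> mspace X" for p q
  proof
    assume "p = q"
    moreover have "dprime X e q q \<le> 0" by (rule dprime_least) simp
    ultimately show "dprime X e p q = 0"
      using gap_le_dprime[OF zero_adm, of q q] by simp
  next
    assume 0: "dprime X e p q = 0"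
    then have eq: "f p / xi X e p = f q / xi X e q" if "f \<in> adm" for f
      using gap_le_dprime[OF that, of p q] by linarith
    have xi_eq: "xi X e p = xi X e q"
      using eq[OF adm_restrict[of "\<lambda>_. 1"]] pq by simp
    have "(\<lambda>x\<in>mspace X. mdist X x p - mdist X e p) \<in> adm"
    proof (rule adm_restrict)
      fix x y assume xy: "x \<in> mspace X" "y \<in> mspace X"
      show "\<bar>(mdist X x p - mdist X e p) - (mdist X y p - mdist X e p)\<bar> \<le> mdist X x y"
        using mdist_triangle[of x X y p] mdist_triangle[of y X x p] xy pq mdist_commute[of X x y]
        by linarith
    qed simp
    from eq[OF this] have "mdist X p p = mdist X q p"
      using pq xi_eq by (simp add: xi_def divide_simps split: if_splits)
    then show "p = q" using pq by (metis mdist_zero)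
  qed
  show "dprime X e p r \<le> dprime X e p q + dprime X e q r" for p q r
  proof (rule dprime_least)
    fix f assume f: "f \<in> adm"
    show "gap f p r \<le> dprime X e p q + dprime X e q r"
      using gap_le_dprime[OF f, of p q] gap_le_dprime[OF f, of q r] by linarith
  qed
qed

lemma mspace_Zspace: "mspace (Zspace X e) = mspace X"
  unfolding Zspace_def by (rule Metric_space.mspace_metric[OF Metric_space_dprime])

lemma mdist_Zspace: "mdist (Zspace X e) = dprime X e"
  unfolding Zspace_def by (rule Metric_space.mdist_metric[OF Metric_space_dprime])

end

end

theory Submission
  imports Defs
begin

text \<open>
  Everything rests on the two-sided estimate

  \<open>d(p,q) \<le> max (\<xi> p) (\<xi> q) d'(p,q) \<le> 3 d(p,q)\<close>,

  that is, \<open>d'\<close> is, up to a constant, the distance \<open>d\<close> scaled down by the size of \<open>\<xi>\<close>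
  (lemmas \<open>mdist_le_max_xi_dprime\<close> and \<open>max_xi_dprime_le\<close>).

  The upper half is a quotient rule.  Since \<open>\<xi>\<close> is 1-Lipschitz, a function \<open>f\<close> with Lipschitz
  constant \<open>L\<close> and growth \<open>\<parallel>f\<parallel> \<le> M \<xi>\<close> satisfies
  \<open>max (\<xi> p) (\<xi> q) \<parallel>f p / \<xi> p - f q / \<xi> q\<parallel> \<le> (M + L) d(p,q)\<close>; the functions in the supremum
  defining \<open>d'\<close> have \<open>L = 1\<close> and \<open>M = 2\<close>.  The lower half comes from the single test function
  \<open>x \<mapsto> d(x,p) - d(e,p)\<close>.

  Every Lipschitz function on \<open>X\<close> has growth at most a multiple of \<open>\<xi>\<close>, so the same quotient
  rule, now for values in \<open>E\<close>, followed by the lower half shows that \<open>f / \<xi>\<close> is Lipschitz for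
  \<open>d'\<close>.  Conversely, \<open>d' \<le> 4\<close> makes every Lipschitz function \<open>g\<close> on \<open>Z\<close> bounded, and then
  the product rule for \<open>\<xi> g\<close> together with the upper half shows that \<open>\<xi> g\<close> is Lipschitz for \<open>d\<close>.
  Multiplication by the nowhere vanishing function \<open>1 / \<xi>\<close> is linear and injective, and it
  changes no set of the form \<open>C(f - h)\<close>, so it preserves and reflects disjointness.
\<close>

section \<open>The weight and the quotient rule\<close>

lemma xi_ge_1: "1 \<le> xi X e x"
  by (simp add: xi_def)

lemma xi_pos [simp]: "0 < xi X e x"
  by (simp add: xi_def)

lemma xi_neq_0 [simp]: "xi X e x \<noteq> 0"
  using xi_pos[of X e x] by linarith

lemma abs_xi [simp]: "\<bar>xi X e x\<bar> = xi X e x"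
  by (simp add: less_imp_le)

lemma xi_nonexpansive:
  assumes "e \<in> mspace X" "p \<in> mspace X" "q \<in> mspace X"
  shows "\<bar>xi X e p - xi X e q\<bar> \<le> mdist X p q"
  using mdist_triangle[of p X q e] mdist_triangle[of q X p e] mdist_commute[of X p q] assms
  by (auto simp: xi_def max_def)

lemma norm_le_xi:
  fixes f :: "'a \<Rightarrow> 'b::real_normed_vector"
  assumes "norm (f x - f e) \<le> L * mdist X x e" "0 \<le> L"
  shows "norm (f x) \<le> (norm (f e) + L) * xi X e x"
proof -
  have "norm (f x) \<le> norm (f e) + L * mdist X x e"
    using norm_triangle_ineq[of "f e" "f x - f e"] assms(1) by simp
  also have "\<dots> \<le> norm (f e) * xi X e x + L * xi X e x"
    using assms(2) mult_left_mono[OF xi_ge_1[of X e x], of "norm (f e)"]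
    by (intro add_mono mult_left_mono) (auto simp: xi_def)
  finally show ?thesis by (simp add: algebra_simps)
qed

text \<open>
  Multiplied by \<open>\<xi> q\<close>, the increment of \<open>f / \<xi>\<close> is the increment of \<open>f\<close> plus
  \<open>(\<xi> q - \<xi> p) / \<xi> p\<close> times \<open>f p\<close>, and the growth bound at \<open>p\<close> cancels the denominator.
  The two points do not play symmetric parts here; exchanging them gives the same
  bound for the weight \<open>\<xi> p\<close>, and so for the larger of the two weights.
\<close>

lemma quotient_rule_aux:
  fixes f :: "'a \<Rightarrow> 'b::real_normed_vector"
  assumes X: "e \<in> mspace X" "p \<in> mspace X" "q \<in> mspace X"
    and M: "norm (f p) \<le> M * xi X e p"
    and L: "norm (f p - f q) \<le> L * mdist X p q"
  shows "xi X e q * norm (f p /\<^sub>R xi X e p - f q /\<^sub>R xi X e q) \<le> (M + L) * mdist X p q"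
proof -
  let ?a = "xi X e p" and ?b = "xi X e q"
  have split: "?b *\<^sub>R (f p /\<^sub>R ?a - f q /\<^sub>R ?b) = ((?b - ?a) / ?a) *\<^sub>R f p + (f p - f q)"
    by (simp add: algebra_simps diff_divide_distrib divide_inverse)
  have "norm (f p) / ?a \<le> M"
    using M by (simp add: divide_simps)
  moreover have "\<bar>?b - ?a\<bar> \<le> mdist X p q"
    using xi_nonexpansive[OF X] by linarith
  ultimately have "\<bar>?b - ?a\<bar> * (norm (f p) / ?a) \<le> mdist X p q * M"
    by (intro mult_mono) (auto simp: less_imp_le)
  then have "norm (((?b - ?a) / ?a) *\<^sub>R f p) \<le> M * mdist X p q"
    by (simp add: mult.commute)
  then have "norm (?b *\<^sub>R (f p /\<^sub>R ?a - f q /\<^sub>R ?b)) \<le> M * mdist X p q + L * mdist X p q"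
    unfolding split using L by (rule norm_triangle_mono)
  then show ?thesis by (simp add: distrib_right)
qed

lemma quotient_rule:
  fixes f :: "'a \<Rightarrow> 'b::real_normed_vector"
  assumes X: "e \<in> mspace X" "p \<in> mspace X" "q \<in> mspace X"
    and M: "norm (f p) \<le> M * xi X e p" "norm (f q) \<le> M * xi X e q"
    and L: "norm (f p - f q) \<le> L * mdist X p q"
  shows "max (xi X e p) (xi X e q) * norm (f p /\<^sub>R xi X e p - f q /\<^sub>R xi X e q)
    \<le> (M + L) * mdist X p q"
proof -
  have "norm (f q - f p) \<le> L * mdist X q p"
    using L by (simp add: norm_minus_commute mdist_commute)
  from quotient_rule_aux[OF X(1,3,2) M(2) this]
  have "xi X e p * norm (f p /\<^sub>R xi X e p - f q /\<^sub>R xi X e q) \<le> (M + L) * mdist X p q"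
    by (simp add: norm_minus_commute mdist_commute)
  with quotient_rule_aux[OF X M(1) L] show ?thesis
    by (simp add: max_def)
qed

section \<open>Comparison of the two metrics\<close>

lemma admissible_gap_le:
  fixes f :: "'a \<Rightarrow> real"
  assumes X: "e \<in> mspace X" "p \<in> mspace X" "q \<in> mspace X"
    and f: "f \<in> Lip X" "Lip_const X f \<le> 1" "\<bar>f e\<bar> \<le> 1"
  shows "max (xi X e p) (xi X e q) * \<bar>f p / xi X e p - f q / xi X e q\<bar> \<le> 3 * mdist X p q"
proof -
  have 1: "norm (f x - f y) \<le> 1 * mdist X x y" if "x \<in> mspace X" "y \<in> mspace X" for x y
    using dist_le_Lip_const[OF f(1) that] mult_right_mono[OF f(2) mdist_nonneg[of X x y]]
    by (simp add: dist_norm)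
  have 2: "norm (f x) \<le> 2 * xi X e x" if "x \<in> mspace X" for x
  proof -
    have "norm (f x) \<le> (norm (f e) + 1) * xi X e x"
      using norm_le_xi[where f = f, OF 1[OF that X(1)]] by simp
    also have "\<dots> \<le> 2 * xi X e x"
      using f(3) by (intro mult_right_mono) (auto simp: less_imp_le)
    finally show ?thesis .
  qed
  show ?thesis
    using quotient_rule[where f = f, OF X 2[OF X(2)] 2[OF X(3)] 1[OF X(2,3)]]
    by (simp add: divide_inverse mult.commute)
qed

lemma admissible_gap_le_dprime:
  fixes f :: "'a \<Rightarrow> real"
  assumes X: "e \<in> mspace X" "p \<in> mspace X" "q \<in> mspace X"
    and f: "f \<in> Lip X" "Lip_const X f \<le> 1" "\<bar>f e\<bar> \<le> 1"
  shows "\<bar>f p / xi X e p - f q / xi X e q\<bar> \<le> dprime X e p q"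
  unfolding dprime_def
proof (rule cSup_upper)
  have "max (xi X e p) (xi X e q) > 0"
    by (simp add: less_max_iff_disj)
  then have "\<bar>g p / xi X e p - g q / xi X e q\<bar> \<le> 3 * mdist X p q / max (xi X e p) (xi X e q)"
    if "g \<in> Lip X" "Lip_const X g \<le> 1" "\<bar>g e\<bar> \<le> 1" for g
    using admissible_gap_le[OF X that] by (simp add: pos_le_divide_eq mult.commute)
  then show "bdd_above {\<bar>f p / xi X e p - f q / xi X e q\<bar> | f :: 'a \<Rightarrow> real.
          f \<in> Lip X \<and> Lip_const X f \<le> 1 \<and> \<bar>f e\<bar> \<le> 1}"
    by (auto intro!: bdd_aboveI)
qed (use f in blast)

lemma max_xi_dprime_le:
  assumes X: "e \<in> mspace X" "p \<in> mspace X" "q \<in> mspace X"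
  shows "max (xi X e p) (xi X e q) * dprime X e p q \<le> 3 * mdist X p q"
proof -
  let ?m = "max (xi X e p) (xi X e q)"
  have pos: "?m > 0"
    by (simp add: less_max_iff_disj)
  have zero: "(\<lambda>x\<in>mspace X. 0 :: real) \<in> Lip X" "Lip_const X (\<lambda>x\<in>mspace X. 0 :: real) \<le> 1"
    "\<bar>(\<lambda>x\<in>mspace X. 0 :: real) e\<bar> \<le> 1"
    using X(1) by (auto intro: Lip_zero Lip_const_le)
  have "dprime X e p q \<le> 3 * mdist X p q / ?m"
    unfolding dprime_def
  proof (rule cSup_least)
    show "{\<bar>f p / xi X e p - f q / xi X e q\<bar> | f :: 'a \<Rightarrow> real.
          f \<in> Lip X \<and> Lip_const X f \<le> 1 \<and> \<bar>f e\<bar> \<le> 1} \<noteq> {}"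
      using zero by blast
  next
    fix r
    assume "r \<in> {\<bar>f p / xi X e p - f q / xi X e q\<bar> | f :: 'a \<Rightarrow> real.
          f \<in> Lip X \<and> Lip_const X f \<le> 1 \<and> \<bar>f e\<bar> \<le> 1}"
    then show "r \<le> 3 * mdist X p q / ?m"
      using pos admissible_gap_le[OF X] by (auto simp: pos_le_divide_eq mult.commute)
  qed
  then show ?thesis
    using pos by (simp add: pos_le_divide_eq mult.commute)
qed

text \<open>
  Subtracting \<open>d(e,p)\<close> makes the test function vanish at \<open>e\<close>, and its value at \<open>p\<close> is then
  nonpositive.  As \<open>p\<close> is the point of smaller weight, the two resulting terms
  \<open>d(p,q) / \<xi>(q)\<close> and \<open>d(e,p) (1 / \<xi>(p) - 1 / \<xi>(q))\<close> have the same sign and cannot cancel.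
\<close>

lemma mdist_le_xi_dprime:
  assumes X: "e \<in> mspace X" "p \<in> mspace X" "q \<in> mspace X"
    and le: "xi X e p \<le> xi X e q"
  shows "mdist X p q \<le> xi X e q * dprime X e p q"
proof -
  let ?f = "\<lambda>x\<in>mspace X. mdist X x p - mdist X e p"
  have 1: "dist (mdist X x p - mdist X e p) (mdist X y p - mdist X e p) \<le> 1 * mdist X x y"
    if "x \<in> mspace X" "y \<in> mspace X" for x y
    using mdist_triangle[of x X y p] mdist_triangle[of y X x p] that X(2) mdist_commute[of X x y]
    by (simp add: dist_real_def)
  have f: "?f \<in> Lip X" "Lip_const X ?f \<le> 1" "\<bar>?f e\<bar> \<le> 1"
    using X(1) by (auto intro!: Lip_restrict[OF 1] Lip_const_le simp: 1[simplified])
  have "mdist X e p / xi X e q \<le> mdist X e p / xi X e p"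
    using le by (simp add: frac_le)
  moreover have "?f p = - mdist X e p"
    using X(2) mdist_zero[of p X p] by simp
  moreover have "?f q = mdist X p q - mdist X e p"
    using X(3) by (simp add: mdist_commute)
  ultimately have "mdist X p q / xi X e q \<le> ?f q / xi X e q - ?f p / xi X e p"
    by (simp only: diff_divide_distrib minus_divide_left[symmetric])
  also have "\<dots> \<le> dprime X e p q"
    using admissible_gap_le_dprime[OF X f] by linarith
  finally show ?thesis
    by (simp add: pos_divide_le_eq mult.commute)
qed

lemma mdist_le_max_xi_dprime:
  assumes X: "e \<in> mspace X" "p \<in> mspace X" "q \<in> mspace X"
  shows "mdist X p q \<le> max (xi X e p) (xi X e q) * dprime X e p q"
proof (cases "xi X e p \<le> xi X e q")
  case True
  then show ?thesis using mdist_le_xi_dprime[OF X] by (simp add: max_def)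
next
  case False
  have "dprime X e q p = dprime X e p q"
    by (rule Metric_space.commute[OF Metric_space_dprime[OF X(1)]])
  with False show ?thesis
    using mdist_le_xi_dprime[OF X(1,3,2)] by (simp add: max_def mdist_commute)
qed

section \<open>Division by the weight as a map of Lipschitz spaces\<close>

lemma Lip_nonneg_bound:
  assumes "f \<in> Lip X"
  obtains B where "0 \<le> B"
    "\<And>x y. x \<in> mspace X \<Longrightarrow> y \<in> mspace X \<Longrightarrow> norm (f x - f y) \<le> B * mdist X x y"
proof -
  obtain B where
    B: "\<And>x y. x \<in> mspace X \<Longrightarrow> y \<in> mspace X \<Longrightarrow> dist (f x) (f y) \<le> B * mdist X x y"
    using assms unfolding Lip_iff by meson
  show thesis
  proof (rule that[of "max B 0"])
    fix x y assume "x \<in> mspace X" "y \<in> mspace X"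
    then show "norm (f x - f y) \<le> max B 0 * mdist X x y"
      using B[of x y] mult_right_mono[OF max.cobounded1[of B 0] mdist_nonneg[of X x y]]
      by (simp add: dist_norm)
  qed simp
qed

lemma div_xi_in_Lip:
  fixes f :: "'a \<Rightarrow> 'b::real_normed_vector"
  assumes e: "e \<in> mspace X" and f: "f \<in> Lip X"
  shows "div_xi X e f \<in> Lip (Zspace X e)"
proof -
  obtain L where L: "0 \<le> L"
    "\<And>x y. x \<in> mspace X \<Longrightarrow> y \<in> mspace X \<Longrightarrow> norm (f x - f y) \<le> L * mdist X x y"
    using Lip_nonneg_bound[OF f] by blast
  define M where "M = norm (f e) + L"
  have M: "norm (f x) \<le> M * xi X e x" if "x \<in> mspace X" for x
    unfolding M_def by (rule norm_le_xi[OF L(2)[OF that e] L(1)])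
  have coeff_nonneg: "0 \<le> M + L"
    using L(1) by (simp add: M_def)
  have "(\<lambda>x\<in>mspace (Zspace X e). f x /\<^sub>R xi X e x) \<in> Lip (Zspace X e)"
  proof (rule Lip_restrict[where B = "M + L"])
    fix p q assume "p \<in> mspace (Zspace X e)" "q \<in> mspace (Zspace X e)"
    then have pq: "p \<in> mspace X" "q \<in> mspace X"
      by (simp_all add: mspace_Zspace[OF e])
    let ?m = "max (xi X e p) (xi X e q)"
    have "?m * norm (f p /\<^sub>R xi X e p - f q /\<^sub>R xi X e q) \<le> (M + L) * mdist X p q"
      by (rule quotient_rule[OF e pq M[OF pq(1)] M[OF pq(2)] L(2)[OF pq]])
    also have "\<dots> \<le> (M + L) * (?m * dprime X e p q)"
      by (rule mult_left_mono[OF mdist_le_max_xi_dprime[OF e pq] coeff_nonneg])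
    finally have "?m * norm (f p /\<^sub>R xi X e p - f q /\<^sub>R xi X e q)
        \<le> ?m * ((M + L) * dprime X e p q)"
      by (simp only: mult.left_commute)
    moreover have "0 < ?m"
      by (simp add: less_max_iff_disj)
    ultimately show "dist (f p /\<^sub>R xi X e p) (f q /\<^sub>R xi X e q)
        \<le> (M + L) * mdist (Zspace X e) p q"
      by (simp only: dist_norm mdist_Zspace[OF e] mult_le_cancel_left_pos)
  qed
  then show ?thesis
    by (simp add: div_xi_def mspace_Zspace[OF e])
qed

text \<open>
  The converse is the product rule for \<open>\<xi> g\<close>.  It needs \<open>g\<close> to be bounded, which holds because
  \<open>Z\<close> has diameter at most 4.
\<close>

lemma mult_xi_in_Lip:
  fixes g :: "'a \<Rightarrow> 'b::real_normed_vector"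
  assumes e: "e \<in> mspace X" and g: "g \<in> Lip (Zspace X e)"
  shows "(\<lambda>x\<in>mspace X. xi X e x *\<^sub>R g x) \<in> Lip X"
proof -
  obtain L where L0: "0 \<le> L" and L:
    "\<And>x y. x \<in> mspace X \<Longrightarrow> y \<in> mspace X \<Longrightarrow> norm (g x - g y) \<le> L * dprime X e x y"
    using Lip_nonneg_bound[OF g] by (auto simp: mspace_Zspace[OF e] mdist_Zspace[OF e])
  define M where "M = norm (g e) + 4 * L"
  have M: "norm (g x) \<le> M" if x: "x \<in> mspace X" for x
  proof -
    have "norm (g x - g e) \<le> L * 4"
      using L[OF x e] mult_left_mono[OF dprime_le_4[OF e x e] L0] by linarith
    then show ?thesis
      using norm_triangle_ineq[of "g e" "g x - g e"] by (simp add: M_def)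
  qed
  show ?thesis
  proof (rule Lip_restrict[where B = "M + 3 * L"])
    fix p q assume pq: "p \<in> mspace X" "q \<in> mspace X"
    let ?a = "xi X e p" and ?b = "xi X e q"
    have split: "?a *\<^sub>R g p - ?b *\<^sub>R g q = (?a - ?b) *\<^sub>R g p + ?b *\<^sub>R (g p - g q)"
      by (simp add: algebra_simps)
    have 1: "norm ((?a - ?b) *\<^sub>R g p) \<le> mdist X p q * M"
      using xi_nonexpansive[OF e pq] M[OF pq(1)] by (auto intro!: mult_mono)
    have d_nonneg: "0 \<le> dprime X e p q"
      by (rule Metric_space.nonneg[OF Metric_space_dprime[OF e]])
    have "?b * norm (g p - g q) \<le> ?b * (L * dprime X e p q)"
      by (rule mult_left_mono[OF L[OF pq]]) (simp add: less_imp_le)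
    also have "\<dots> = L * (?b * dprime X e p q)"
      by simp
    also have "\<dots> \<le> L * (max ?a ?b * dprime X e p q)"
      using L0 d_nonneg by (intro mult_left_mono mult_right_mono) auto
    also have "\<dots> \<le> L * (3 * mdist X p q)"
      by (rule mult_left_mono[OF max_xi_dprime_le[OF e pq] L0])
    finally have 2: "norm (?b *\<^sub>R (g p - g q)) \<le> L * (3 * mdist X p q)"
      by (simp add: less_imp_le)
    show "dist (?a *\<^sub>R g p) (?b *\<^sub>R g q) \<le> (M + 3 * L) * mdist X p q"
      using norm_triangle_mono[OF 1 2] unfolding dist_norm split
      by (simp add: algebra_simps)
  qed
qed

lemma mult_xi_div_xi:
  assumes "f \<in> extensional (mspace X)"
  shows "(\<lambda>x\<in>mspace X. xi X e x *\<^sub>R div_xi X e f x) = f"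
  using assms by (auto simp: div_xi_def fun_eq_iff extensional_def)

lemma div_xi_mult_xi:
  assumes "g \<in> extensional (mspace X)"
  shows "div_xi X e (\<lambda>x\<in>mspace X. xi X e x *\<^sub>R g x) = g"
  using assms by (auto simp: div_xi_def fun_eq_iff extensional_def)

lemma div_xi_in_Lip_iff:
  assumes e: "e \<in> mspace X" and f: "f \<in> extensional (mspace X)"
  shows "f \<in> Lip X \<longleftrightarrow> div_xi X e f \<in> Lip (Zspace X e)"
  using div_xi_in_Lip[OF e, of f] mult_xi_in_Lip[OF e, of "div_xi X e f"] mult_xi_div_xi[OF f, of e]
  by auto

lemma bij_betw_div_xi:
  assumes e: "e \<in> mspace X"
  shows "bij_betw (div_xi X e) (Lip X) (Lip (Zspace X e))"
proof (rule bij_betw_byWitness[where f' = "\<lambda>g. \<lambda>x\<in>mspace X. xi X e x *\<^sub>R g x"])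
  show "\<forall>f\<in>Lip X. (\<lambda>x\<in>mspace X. xi X e x *\<^sub>R div_xi X e f x) = f"
    by (auto intro: mult_xi_div_xi simp: Lip_def)
  show "\<forall>g\<in>Lip (Zspace X e). div_xi X e (\<lambda>x\<in>mspace X. xi X e x *\<^sub>R g x) = g"
    by (auto intro: div_xi_mult_xi simp: Lip_def mspace_Zspace[OF e])
qed (use div_xi_in_Lip[OF e] mult_xi_in_Lip[OF e] in blast)+

lemma linear_map_div_xi:
  assumes e: "e \<in> mspace X"
  shows "linear_map (mspace X) (Lip X) (mspace (Zspace X e)) (Lip (Zspace X e)) (div_xi X e)"
  using div_xi_in_Lip[OF e]
  by (auto simp: linear_map_def mspace_Zspace[OF e] div_xi_def fun_eq_iff scaleR_add_right
      restrict_def)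

lemma fun_perp_div_xi:
  "fun_perp (mspace X) (div_xi X e h) (div_xi X e f) (div_xi X e g)
    \<longleftrightarrow> fun_perp (mspace X) h f g"
  by (auto simp: fun_perp_def div_xi_def)

lemma biseparating_div_xi:
  assumes e: "e \<in> mspace X"
  shows "biseparating (mspace X) (Lip X) (mspace (Zspace X e)) (Lip (Zspace X e)) (div_xi X e)"
  by (simp add: biseparating_def bij_betw_div_xi[OF e] mspace_Zspace[OF e] fun_perp_div_xi)

theorem proposition8p2:
  fixes X :: "'a metric" and e :: 'a
  assumes "mcomplete_of X" and "e \<in> mspace X"
  shows "(\<forall>f \<in> mspace X \<rightarrow>\<^sub>E (UNIV :: 'b::banach set).
            f \<in> Lip X \<longleftrightarrow> div_xi X e f \<in> Lip (Zspace X e))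
       \<and> linear_map (mspace X) (Lip X :: ('a \<Rightarrow> 'b) set)
            (mspace (Zspace X e)) (Lip (Zspace X e) :: ('a \<Rightarrow> 'b) set) (div_xi X e)
       \<and> biseparating (mspace X) (Lip X :: ('a \<Rightarrow> 'b) set)
            (mspace (Zspace X e)) (Lip (Zspace X e) :: ('a \<Rightarrow> 'b) set) (div_xi X e)"
  using div_xi_in_Lip_iff[OF assms(2)] linear_map_div_xi[OF assms(2)]
    biseparating_div_xi[OF assms(2)]
  by (auto simp: PiE_def)

end
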